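(* Let $H,U$ be Hilbert spaces, let $A:\operatorname{dom}(A)\subset H\to H$ generate a $C_0$-semigroup $\{T(t)\}_{t\ge 0}$ on $H$ with $\|T(t)\|_{\mathcal{B}(H)}\le Me^{\nu t}$ for all $t\ge 0$, where $M\ge 1$, $\nu>0$, and let $B\in\mathcal{B}(U,H)$. Assume that there is a compact operator $F\in\mathcal{B}(H,U)$ such that $A+BF$ generates a $C_0$-semigroup $\{T_{BF}(t)\}_{t\ge0}$ with $\|T_{BF}(t)\|_{\mathcal{B}(H)}\le Ne^{-\xi t}$ for all $t\ge 0$, where $N\ge 1$, $\xi>0$. Let $f:U\to U$ be such that $f\circ F:H\to U$ is globally Lipschitz continuous and, for a constant $\theta_f>0$, $\|f(Fx)-Fx\|_U\le\theta_f\|x\|_H$ for all $x\in H$. Assume $$\theta_f<\xi\beta^{-1},\qquad \beta:=MN\|B\|_{\mathcal{B}(U,H)} .$$ Let $\tau_*>0$ be such that $\Psi_\tau$ (defined in the context) is power stable for all $\tau\in(0,\tau_* )$. Then for every $\tau\in(0,\tau_* )$ the closed-loop system $$\dot x(t)=Ax(t)+Bf(u(t)),\quad x(0)=x_0,\qquad u(t)=Fx(k\tau)\ \text{ for } t\in[k\tau,(k+1)\tau),\ k\in\mathbb{N}_0,$$ is exponentially stable, i.e. there exist $G\ge 1$ and $\chi>0$ such that for all $x_0\in H$ the (mild) solution satisfies $$\|x(t)\|_H\le Ge^{-\chi t}\|x_0\|_H\qquad\text{for all } t\ge 0 .$$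
   Context: $\mathbb{N}_0=\{0,1,2,\dots\}$. $\mathcal{B}(U,H)$ denotes the bounded linear operators from $U$ to $H$, and $\mathcal{B}(H)=\mathcal{B}(H,H)$. For $\tau>0$, $\Psi_\tau:H\to H$ is the map $$\Psi_\tau(x):=T(\tau)x+\int_0^\tau T(s)Bf(Fx)\,\mathrm{d}s .$$ $\Psi_\tau$ is called power stable if there exist $L\in\mathbb{N}$ and $q\in(0,1)$ such that for all $x_0\in H$ the sequence defined by $x_{k+1}=\Psi_\tau(x_k)$, $k\in\mathbb{N}_0$, satisfies $\|x_k\|_H\le Lq^k\|x_0\|_H$ for all $k\in\mathbb{N}_0$. Under the hypotheses of the claim (apart from the choice of $\tau_*$), such a $\tau_*>0$ exists. The mild solution of the closed-loop system is the continuous function with $x(0)=x_0$ and $x(t)=T(t-k\tau)x(k\tau)+\int_{k\tau}^{t}T(t-s)Bf(Fx(k\tau))\,\mathrm{d}s$ for $t\in[k\tau,(k+1)\tau]$, $k\in\mathbb{N}_0$. *)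

theory Defs
  imports "HOL-Analysis.Analysis"
begin

text \<open>
  Hilbert spaces are types of sort \<open>{real_inner, banach}\<close>. A complex Hilbert space is
  covered through its underlying real Hilbert space with inner product \<open>Re \<langle>x, y\<rangle>\<close>, which
  has the same norm.
\<close>

text \<open>Only the values \<open>T t\<close> for \<open>t \<ge> 0\<close> are relevant.\<close>

definition C0_semigroup :: "(real \<Rightarrow> 'h::{real_inner, banach} \<Rightarrow>\<^sub>L 'h) \<Rightarrow> bool" where
  "C0_semigroup T \<longleftrightarrow>
     T 0 = id_blinfun \<and>
     (\<forall>s\<ge>0. \<forall>t\<ge>0. T (s + t) = T s o\<^sub>L T t) \<and>
     (\<forall>x. ((\<lambda>t. T t x) \<longlongrightarrow> x) (at_right 0))"

text \<open>
  The unbounded operator \<open>A : dom(A) \<subset> H \<rightarrow> H\<close> is given by its domain \<open>D\<close> and a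
  function \<open>A\<close> whose values outside \<open>D\<close> play no role. Linearity of \<open>D\<close> and of \<open>A\<close> on \<open>D\<close>
  follows from the generator property.
\<close>

definition generates_C0_semigroup ::
  "'h set \<Rightarrow> ('h \<Rightarrow> 'h) \<Rightarrow> (real \<Rightarrow> 'h::{real_inner, banach} \<Rightarrow>\<^sub>L 'h) \<Rightarrow> bool" where
  "generates_C0_semigroup D A T \<longleftrightarrow>
     C0_semigroup T \<and>
     D = {x. \<exists>y. ((\<lambda>h. (T h x - x) /\<^sub>R h) \<longlongrightarrow> y) (at_right 0)} \<and>
     (\<forall>x\<in>D. ((\<lambda>h. (T h x - x) /\<^sub>R h) \<longlongrightarrow> A x) (at_right 0))"

definition compact_operator :: "('a::real_normed_vector \<Rightarrow>\<^sub>L 'b::real_normed_vector) \<Rightarrow> bool" where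
  "compact_operator F \<longleftrightarrow> (\<forall>S. bounded S \<longrightarrow> compact (closure (blinfun_apply F ` S)))"

definition sample_map ::
  "(real \<Rightarrow> 'h::{real_inner, banach} \<Rightarrow>\<^sub>L 'h) \<Rightarrow> ('u::{real_inner, banach} \<Rightarrow>\<^sub>L 'h) \<Rightarrow>
   ('h \<Rightarrow>\<^sub>L 'u) \<Rightarrow> ('u \<Rightarrow> 'u) \<Rightarrow> real \<Rightarrow> 'h \<Rightarrow> 'h" where
  "sample_map T B F f \<tau> x = T \<tau> x + integral {0..\<tau>} (\<lambda>s. T s (B (f (F x))))"

definition power_stable :: "('h::real_normed_vector \<Rightarrow> 'h) \<Rightarrow> bool" where
  "power_stable \<Psi> \<longleftrightarrow>
     (\<exists>L::nat. \<exists>q::real. L \<ge> 1 \<and> 0 < q \<and> q < 1 \<and>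
        (\<forall>x :: nat \<Rightarrow> 'h. (\<forall>k. x (Suc k) = \<Psi> (x k)) \<longrightarrow>
           (\<forall>k. norm (x k) \<le> real L * q ^ k * norm (x 0))))"

text \<open>Only the restriction of \<open>x\<close> to \<open>[0, \<infinity>)\<close> is constrained.\<close>

definition mild_solution ::
  "(real \<Rightarrow> 'h::{real_inner, banach} \<Rightarrow>\<^sub>L 'h) \<Rightarrow> ('u::{real_inner, banach} \<Rightarrow>\<^sub>L 'h) \<Rightarrow>
   ('h \<Rightarrow>\<^sub>L 'u) \<Rightarrow> ('u \<Rightarrow> 'u) \<Rightarrow> real \<Rightarrow> 'h \<Rightarrow> (real \<Rightarrow> 'h) \<Rightarrow> bool" where
  "mild_solution T B F f \<tau> x0 x \<longleftrightarrow>
     continuous_on {0..} x \<and> x 0 = x0 \<and>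
     (\<forall>k::nat. \<forall>t\<in>{real k * \<tau>..(real k + 1) * \<tau>}.
        x t = T (t - real k * \<tau>) (x (real k * \<tau>)) +
              integral {real k * \<tau>..t} (\<lambda>s. T (t - s) (B (f (F (x (real k * \<tau>)))))))"

text \<open>The mild solution exists and is unique on \<open>[0, \<infinity>)\<close>.\<close>

lemma C0_semigroup_orbit_continuous:
  fixes T :: "real \<Rightarrow> 'h::{real_inner, banach} \<Rightarrow>\<^sub>L 'h"
  assumes T: "C0_semigroup T"
    and bd: "\<forall>t\<ge>0. norm (T t) \<le> M * exp (\<nu> * t)"
    and M: "M \<ge> 1" and nu: "\<nu> > 0"
  shows "continuous_on {0..} (\<lambda>t. T t x)"
  unfolding continuous_on_iff
proof (intro ballI allI impI)
  fix a e :: real assume a: "a \<in> {0..}" and e: "e > 0"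
  define K where "K = M * exp (\<nu> * (a + 1))"
  have K: "K > 0" using M by (simp add: K_def)
  have "((\<lambda>t. T t x) \<longlongrightarrow> x) (at_right 0)" using T by (simp add: C0_semigroup_def)
  then have "\<forall>\<^sub>F t in at_right 0. dist (T t x) x < e / K"
    using e K by (intro tendstoD) auto
  then obtain d where d: "d > 0" "\<And>t. t > 0 \<Longrightarrow> t < d \<Longrightarrow> dist (T t x) x < e / K"
    unfolding eventually_at_right_field by auto
  have main: "dist (T t x) (T s x) < e" if "0 \<le> s" "s < t" "t < s + d" "s \<le> a + 1" for s t
  proof -
    have "T t = T s o\<^sub>L T (t - s)"
      using T that unfolding C0_semigroup_def
      by (metis add.commute diff_add_cancel diff_ge_0_iff_ge less_eq_real_def)
    then have eq: "T t x - T s x = T s (T (t - s) x - x)" by (simp add: blinfun.diff_right)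
    have "norm (T s) \<le> M * exp (\<nu> * s)" using bd that by simp
    also have "\<dots> \<le> K" unfolding K_def using M nu that by (intro mult_left_mono) auto
    finally have "norm (T s) \<le> K" .
    then have "norm (T t x - T s x) \<le> K * norm (T (t - s) x - x)"
      unfolding eq by (meson mult_right_mono norm_blinfun norm_ge_zero order_trans)
    also have "\<dots> < e" using d(2)[of "t - s"] that K
      by (simp add: dist_norm pos_less_divide_eq mult.commute)
    finally show ?thesis by (simp add: dist_norm)
  qed
  show "\<exists>d>0. \<forall>t\<in>{0..}. dist t a < d \<longrightarrow> dist (T t x) (T a x) < e"
  proof (intro exI[of _ "min d 1"] conjI ballI impI)
    show "min d 1 > 0" using d by simp
    fix t assume t: "t \<in> {0..}" "dist t a < min d 1"
    consider "t < a" | "t = a" | "a < t" by linarith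
    then show "dist (T t x) (T a x) < e"
    proof cases
      case 1 then show ?thesis using main[of t a] t by (simp add: dist_commute dist_real_def)
    next
      case 2 then show ?thesis using e by simp
    next
      case 3 then show ?thesis using main[of a t] t a by (simp add: dist_real_def)
    qed
  qed
qed

lemma integral_reflect_shift:
  fixes g :: "real \<Rightarrow> 'a::banach"
  assumes "continuous_on {0..} g" "a \<le> t"
  shows "integral {a..t} (\<lambda>s. g (t - s)) = integral {0..t - a} g"
proof -
  have "g integrable_on {0..t - a}"
    by (intro integrable_continuous_real continuous_on_subset[OF assms(1)]) auto
  then have "(g has_integral integral {0..t - a} g) (cbox 0 (t - a))"
    by (simp add: integrable_integral)
  from has_integral_affinity[OF this, of "-1" t]
  have "((\<lambda>s. g (t - s)) has_integral integral {0..t - a} g) ((\<lambda>x. t - x) ` {0..t - a})"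
    by simp
  moreover have "(\<lambda>x. t - x) ` {0..t - a} = {a..t}"
    using assms by (simp add: image_diff_atLeastAtMost)
  ultimately show ?thesis by (simp add: integral_unique)
qed

lemma sample_map_continuous:
  fixes T :: "real \<Rightarrow> 'h::{real_inner, banach} \<Rightarrow>\<^sub>L 'h"
    and B :: "'u::{real_inner, banach} \<Rightarrow>\<^sub>L 'h" and F :: "'h \<Rightarrow>\<^sub>L 'u"
  assumes "C0_semigroup T"
    and "\<forall>t\<ge>0. norm (T t) \<le> M * exp (\<nu> * t)" "M \<ge> 1" "\<nu> > 0"
  shows "continuous_on {0..r} (\<lambda>s. sample_map T B F f s c)"
proof -
  have o: "continuous_on {0..r} (\<lambda>t. T t x)" for x
    by (rule continuous_on_subset[OF C0_semigroup_orbit_continuous[OF assms]]) auto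
  then have "continuous_on {0..r} (\<lambda>s. integral {0..s} (\<lambda>s. T s (B (f (F c)))))"
    by (intro indefinite_integral_continuous_1 integrable_continuous_real)
  then show ?thesis unfolding sample_map_def by (intro continuous_on_add o)
qed

lemma mild_solution_step:
  fixes T :: "real \<Rightarrow> 'h::{real_inner, banach} \<Rightarrow>\<^sub>L 'h"
    and B :: "'u::{real_inner, banach} \<Rightarrow>\<^sub>L 'h" and F :: "'h \<Rightarrow>\<^sub>L 'u"
  assumes "C0_semigroup T"
    and "\<forall>t\<ge>0. norm (T t) \<le> M * exp (\<nu> * t)" "M \<ge> 1" "\<nu> > 0"
    and "a \<le> t"
  shows "T (t - a) c + integral {a..t} (\<lambda>s. T (t - s) (B (f (F c)))) = sample_map T B F f (t - a) c"
  using integral_reflect_shift[OF C0_semigroup_orbit_continuous[OF assms(1-4)] assms(5)]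
  by (simp add: sample_map_def)

lemma mild_solution_exists:
  fixes T :: "real \<Rightarrow> 'h::{real_inner, banach} \<Rightarrow>\<^sub>L 'h"
    and B :: "'u::{real_inner, banach} \<Rightarrow>\<^sub>L 'h" and F :: "'h \<Rightarrow>\<^sub>L 'u"
  assumes "C0_semigroup T"
    and "\<forall>t\<ge>0. norm (T t) \<le> M * exp (\<nu> * t)" "M \<ge> 1" "\<nu> > 0"
    and tau: "\<tau> > 0"
  shows "\<exists>x. mild_solution T B F f \<tau> x0 x"
proof -
  let ?\<Psi> = "sample_map T B F f"
  define y where "y k = (?\<Psi> \<tau> ^^ k) x0" for k
  define x where "x t = ?\<Psi> (t - real (nat \<lfloor>t / \<tau>\<rfloor>) * \<tau>) (y (nat \<lfloor>t / \<tau>\<rfloor>))" for t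
  have zero: "?\<Psi> 0 c = c" for c using assms(1) by (simp add: sample_map_def C0_semigroup_def)
  have x_eq: "x t = ?\<Psi> (t - real k * \<tau>) (y k)" if "t \<in> {real k * \<tau>..(real k + 1) * \<tau>}" for k t
  proof (cases "t = (real k + 1) * \<tau>")
    case True
    then have fl: "nat \<lfloor>t / \<tau>\<rfloor> = Suc k"
      using tau by (simp add: floor_add_int[symmetric] nat_add_distrib)
    have "x t = ?\<Psi> (t - real (Suc k) * \<tau>) (y (Suc k))" unfolding x_def fl ..
    also have "\<dots> = y (Suc k)" using True by (simp add: zero algebra_simps)
    also have "\<dots> = ?\<Psi> \<tau> (y k)" by (simp add: y_def)
    finally show ?thesis using True by (simp add: algebra_simps)
  next
    case False
    then have "real k \<le> t / \<tau>" "t / \<tau> < real k + 1"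
      using that tau by (auto simp: field_simps)
    then have "\<lfloor>t / \<tau>\<rfloor> = int k" by (simp add: floor_eq_iff)
    then show ?thesis by (simp add: x_def)
  qed
  have x_y: "x (real k * \<tau>) = y k" for k
    using x_eq[of "real k * \<tau>" k] tau zero by (simp add: algebra_simps)
  have piece: "continuous_on {real k * \<tau>..(real k + 1) * \<tau>} x" for k
  proof -
    have "continuous_on {real k * \<tau>..(real k + 1) * \<tau>} (\<lambda>t. ?\<Psi> (t - real k * \<tau>) (y k))"
      by (rule continuous_on_compose2[OF sample_map_continuous[OF assms(1-4), of \<tau>]])
        (auto intro!: continuous_intros simp: algebra_simps)
    then show ?thesis by (rule continuous_on_eq) (simp add: x_eq)
  qed
  have upto: "continuous_on {0..real n * \<tau>} x" for n
  proof (induction n)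
    case 0 then show ?case by simp
  next
    case (Suc n)
    have "{0..real (Suc n) * \<tau>} = {0..real n * \<tau>} \<union> {real n * \<tau>..(real n + 1) * \<tau>}"
      using tau by (subst ivl_disj_un_two_touch(4)) (simp_all add: algebra_simps)
    then show ?case using continuous_on_closed_Un[OF _ _ Suc piece] by simp
  qed
  have "continuous_on {0..} x"
    unfolding continuous_on_eq_continuous_within
  proof
    fix t :: real assume t: "t \<in> {0..}"
    obtain n where n: "t / \<tau> < real n" using reals_Archimedean2 by blast
    then have n: "t < real n * \<tau>" using tau by (simp add: field_simps)
    have "continuous (at t within {0..real n * \<tau>}) x"
      using upto[of n] t n by (auto simp: continuous_on_eq_continuous_within)
    moreover have "at t within {0..real n * \<tau>} = at t within {0..}"
      by (rule at_within_nhd[of _ "{..<real n * \<tau>}"]) (use n in auto)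
    ultimately show "continuous (at t within {0..}) x" by simp
  qed
  moreover have "x 0 = x0" using x_y[of 0] by (simp add: y_def)
  moreover have "x t = T (t - real k * \<tau>) (x (real k * \<tau>)) +
      integral {real k * \<tau>..t} (\<lambda>s. T (t - s) (B (f (F (x (real k * \<tau>))))))"
    if "t \<in> {real k * \<tau>..(real k + 1) * \<tau>}" for k t
    using mild_solution_step[OF assms(1-4), of "real k * \<tau>" t "y k" B f F] that
    unfolding x_y x_eq[OF that] by simp
  ultimately show ?thesis unfolding mild_solution_def by blast
qed

lemma mild_solution_unique:
  fixes T :: "real \<Rightarrow> 'h::{real_inner, banach} \<Rightarrow>\<^sub>L 'h"
    and B :: "'u::{real_inner, banach} \<Rightarrow>\<^sub>L 'h" and F :: "'h \<Rightarrow>\<^sub>L 'u"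
  assumes x: "mild_solution T B F f \<tau> x0 x" and y: "mild_solution T B F f \<tau> x0 y"
    and tau: "\<tau> > 0" and t: "t \<ge> 0"
  shows "x t = y t"
proof -
  have step: "\<forall>t\<in>{real k * \<tau>..(real k + 1) * \<tau>}. x t = y t" if "x (real k * \<tau>) = y (real k * \<tau>)" for k
    using x y that unfolding mild_solution_def by metis
  have grid: "x (real k * \<tau>) = y (real k * \<tau>)" for k
  proof (induction k)
    case 0 then show ?case using x y by (simp add: mild_solution_def)
  next
    case (Suc k)
    have "real (Suc k) * \<tau> \<in> {real k * \<tau>..(real k + 1) * \<tau>}" using tau by (simp add: algebra_simps)
    then show ?case using step[OF Suc] by blast
  qed
  define k where "k = nat \<lfloor>t / \<tau>\<rfloor>"
  have "real k \<le> t / \<tau>" "t / \<tau> \<le> real k + 1"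
    using t tau unfolding k_def by (auto simp: of_nat_nat)
  then have "t \<in> {real k * \<tau>..(real k + 1) * \<tau>}" using tau by (auto simp: field_simps)
  then show ?thesis using step[OF grid] by blast
qed

end

theory Submission
  imports Defs
begin

text \<open>
  Power stability of the sampled map \<open>\<Psi>\<^sub>\<tau>\<close> controls the solution at the sampling instants
  \<open>k\<tau>\<close>; what remains is the behaviour between them. On the interval \<open>[k\<tau>, (k+1)\<tau>]\<close> the
  control is frozen at \<open>c = x(k\<tau>)\<close>, so \<open>x(k\<tau> + s) = \<Psi>\<^sub>s(c)\<close> for \<open>s \<in> [0, \<tau>]\<close>. Hence the values at
  sampling instants form an orbit of \<open>\<Psi>\<^sub>\<tau>\<close> (\<open>mild_solution_on_sampling_interval\<close>).
  The semigroup bound on the compact interval \<open>[0, \<tau>]\<close> and \<open>\<parallel>f(Fc)\<parallel> \<le> (\<parallel>F\<parallel> + \<theta>\<^sub>f) \<parallel>c\<parallel>\<close> give a constant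
  \<open>K\<close> with \<open>\<parallel>\<Psi>\<^sub>s(c)\<parallel> \<le> K \<parallel>c\<parallel>\<close> for all these \<open>s\<close> (\<open>norm_sample_map_le\<close>). The state can therefore
  grow between two sampling instants by at most the factor \<open>K\<close>, and the geometric decay with
  ratio \<open>q\<close> per period \<open>\<tau>\<close> becomes exponential decay with rate \<open>-(ln q)/\<tau>\<close>
  (\<open>geometric_le_exponential\<close>).
\<close>

lemma mild_solution_on_sampling_interval:
  fixes T :: "real \<Rightarrow> 'h::{real_inner, banach} \<Rightarrow>\<^sub>L 'h"
    and B :: "'u::{real_inner, banach} \<Rightarrow>\<^sub>L 'h" and F :: "'h \<Rightarrow>\<^sub>L 'u"
  assumes T: "C0_semigroup T" "\<forall>t\<ge>0. norm (T t) \<le> M * exp (\<nu> * t)" "M \<ge> 1" "\<nu> > 0"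
    and x: "mild_solution T B F f \<tau> x0 x"
    and t: "t \<in> {real k * \<tau>..(real k + 1) * \<tau>}"
  shows "x t = sample_map T B F f (t - real k * \<tau>) (x (real k * \<tau>))"
  using x t mild_solution_step[OF T, of "real k * \<tau>" t "x (real k * \<tau>)" B f F]
  by (auto simp: mild_solution_def)

text \<open>
  Both terms of \<open>\<Psi>\<^sub>s(c)\<close> involve the semigroup only at times in \<open>[0, \<tau>]\<close>, where its norm is at most
  \<open>M exp (\<nu> \<tau>)\<close>, and the integral extends over a length of at most \<open>\<tau>\<close>. The resulting constant is
  uniform in \<open>s\<close>, as the intersample estimate requires.
\<close>

lemma norm_sample_map_le:
  fixes T :: "real \<Rightarrow> 'h::{real_inner, banach} \<Rightarrow>\<^sub>L 'h"
    and B :: "'u::{real_inner, banach} \<Rightarrow>\<^sub>L 'h" and F :: "'h \<Rightarrow>\<^sub>L 'u"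
  assumes T: "C0_semigroup T" "\<forall>t\<ge>0. norm (T t) \<le> M * exp (\<nu> * t)" "M \<ge> 1" "\<nu> > 0"
    and f: "norm (f (F c)) \<le> \<kappa> * norm c"
    and s: "0 \<le> s" "s \<le> \<tau>"
  shows "norm (sample_map T B F f s c) \<le> M * exp (\<nu> * \<tau>) * (1 + \<tau> * norm B * \<kappa>) * norm c"
proof -
  define R where "R = M * exp (\<nu> * \<tau>)"
  have R: "R \<ge> 0" using T(3) by (simp add: R_def)
  have TR: "norm (T r v) \<le> R * norm v" if "0 \<le> r" "r \<le> \<tau>" for r v
  proof -
    have "norm (T r) \<le> M * exp (\<nu> * r)" using T(2) that by simp
    also have "\<dots> \<le> R" unfolding R_def using T(3,4) that by (intro mult_left_mono) auto
    finally show ?thesis by (meson mult_right_mono norm_blinfun norm_ge_zero order_trans)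
  qed
  define w where "w = B (f (F c))"
  have "norm w \<le> norm B * norm (f (F c))" unfolding w_def by (rule norm_blinfun)
  also have "\<dots> \<le> norm B * (\<kappa> * norm c)" using f by (intro mult_left_mono) auto
  finally have w: "norm w \<le> norm B * \<kappa> * norm c" by (simp add: mult.assoc)
  have "continuous_on {0..s} (\<lambda>r. T r w)"
    by (rule continuous_on_subset[OF C0_semigroup_orbit_continuous[OF T]]) auto
  then have "norm (integral {0..s} (\<lambda>r. T r w)) \<le> R * norm w * (s - 0)"
    using TR s by (intro integral_bound) auto
  also have "\<dots> \<le> R * norm w * \<tau>" using s R by (intro mult_left_mono) auto
  also have "\<dots> \<le> R * (norm B * \<kappa> * norm c) * \<tau>"
    using w R s by (intro mult_right_mono mult_left_mono) auto
  finally have "norm (integral {0..s} (\<lambda>r. T r w)) \<le> R * (norm B * \<kappa> * norm c) * \<tau>" .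
  then have "norm (sample_map T B F f s c) \<le> R * norm c + R * (norm B * \<kappa> * norm c) * \<tau>"
    unfolding sample_map_def w_def[symmetric]
    by (intro norm_triangle_mono TR s)
  then show ?thesis unfolding R_def[symmetric] by (simp add: algebra_simps)
qed

text \<open>
  Since \<open>k \<ge> t/\<tau> - 1\<close> and \<open>q < 1\<close>, the power \<open>q\<^sup>k\<close> is at most \<open>q\<close> raised to the real
  exponent \<open>t/\<tau> - 1\<close>; the incomplete period costs the factor \<open>1/q\<close>.
\<close>

lemma geometric_le_exponential:
  fixes q \<tau> t :: real
  assumes q: "0 < q" "q < 1" and tau: "\<tau> > 0" and t: "t \<le> (real k + 1) * \<tau>"
  shows "q ^ k \<le> inverse q * exp (- (- ln q / \<tau>) * t)"
proof -
  have "t / \<tau> \<le> real k + 1" using t tau by (simp add: field_simps)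
  then have "ln q * (real k + 1) \<le> ln q * (t / \<tau>)"
    using q by (intro mult_left_mono_neg) auto
  then have "exp (ln q * real (Suc k)) \<le> exp (- (- ln q / \<tau>) * t)" by (simp add: algebra_simps)
  also have "exp (ln q * real (Suc k)) = q ^ Suc k"
    using q by (metis exp_ln exp_of_nat2_mult)
  finally show ?thesis
    using q by (simp add: pos_le_divide_eq inverse_eq_divide mult.commute)
qed

theorem corollary1:
  fixes D :: "'h::{real_inner, banach} set"
    and A :: "'h \<Rightarrow> 'h"
    and T T\<^sub>B\<^sub>F :: "real \<Rightarrow> 'h \<Rightarrow>\<^sub>L 'h"
    and B :: "'u::{real_inner, banach} \<Rightarrow>\<^sub>L 'h"
    and F :: "'h \<Rightarrow>\<^sub>L 'u"
    and f :: "'u \<Rightarrow> 'u"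
    and M \<nu> N \<xi> \<theta>\<^sub>f \<beta> \<tau>_star :: real
  assumes "generates_C0_semigroup D A T"
    and "M \<ge> 1" and "\<nu> > 0"
    and "\<And>t. t \<ge> 0 \<Longrightarrow> norm (T t) \<le> M * exp (\<nu> * t)"
    and "compact_operator F"
    and "generates_C0_semigroup D (\<lambda>x. A x + B (F x)) T\<^sub>B\<^sub>F"
    and "N \<ge> 1" and "\<xi> > 0"
    and "\<And>t. t \<ge> 0 \<Longrightarrow> norm (T\<^sub>B\<^sub>F t) \<le> N * exp (- \<xi> * t)"
    and "\<exists>C. C-lipschitz_on UNIV (\<lambda>x. f (F x))"
    and "\<theta>\<^sub>f > 0"
    and "\<And>x. norm (f (F x) - F x) \<le> \<theta>\<^sub>f * norm x"
    and "\<beta> = M * N * norm B"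
    and "\<beta> \<noteq> 0 \<Longrightarrow> \<theta>\<^sub>f < \<xi> * inverse \<beta>"
    and "\<tau>_star > 0"
    and "\<And>\<tau>. 0 < \<tau> \<Longrightarrow> \<tau> < \<tau>_star \<Longrightarrow> power_stable (sample_map T B F f \<tau>)"
  shows "\<forall>\<tau>. 0 < \<tau> \<and> \<tau> < \<tau>_star \<longrightarrow>
           (\<exists>G\<ge>1. \<exists>chi>0. \<forall>x0 x. mild_solution T B F f \<tau> x0 x \<longrightarrow>
              (\<forall>t\<ge>0. norm (x t) \<le> G * exp (- chi * t) * norm x0))"
proof (intro allI impI, elim conjE)
  fix \<tau> :: real assume tau: "0 < \<tau>" "\<tau> < \<tau>_star"
  have T: "C0_semigroup T" "\<forall>t\<ge>0. norm (T t) \<le> M * exp (\<nu> * t)" "M \<ge> 1" "\<nu> > 0"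
    using assms(1-4) by (auto simp: generates_C0_semigroup_def)
  let ?\<Psi> = "sample_map T B F f"
  obtain L :: nat and q :: real where L: "L \<ge> 1" and q: "0 < q" "q < 1"
    and orbit: "\<And>y k. (\<forall>k. y (Suc k) = ?\<Psi> \<tau> (y k)) \<Longrightarrow> norm (y k) \<le> real L * q ^ k * norm (y 0)"
    using assms(16)[OF tau] unfolding power_stable_def by blast
  define \<kappa> where "\<kappa> = norm F + \<theta>\<^sub>f"
  have f: "norm (f (F c)) \<le> \<kappa> * norm c" for c
    using norm_triangle_ineq[of "F c" "f (F c) - F c"] norm_blinfun[of F c] assms(12)[of c]
    by (simp add: \<kappa>_def algebra_simps)
  define K where "K = M * exp (\<nu> * \<tau>) * (1 + \<tau> * norm B * \<kappa>)"
  have "1 * 1 * 1 \<le> K"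
    unfolding K_def using T(3,4) tau \<open>\<theta>\<^sub>f > 0\<close> by (intro mult_mono) (auto simp: \<kappa>_def)
  then have K: "K \<ge> 1" by simp
  define chi where "chi = - ln q / \<tau>"
  define G where "G = K * real L * inverse q"
  have "1 * 1 * 1 \<le> G"
    unfolding G_def using K L q by (intro mult_mono) (auto simp: one_le_inverse)
  then have G: "G \<ge> 1" by simp
  have chi: "chi > 0" using q tau by (simp add: chi_def divide_neg_pos)
  have "norm (x t) \<le> G * exp (- chi * t) * norm x0"
    if x: "mild_solution T B F f \<tau> x0 x" and t: "t \<ge> 0" for x0 x t
  proof -
    note interval = mild_solution_on_sampling_interval[OF T x]
    have "x (real (Suc k) * \<tau>) = ?\<Psi> \<tau> (x (real k * \<tau>))" for k
      using interval[of "real (Suc k) * \<tau>" k] tau by (simp add: algebra_simps)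
    then have grid: "norm (x (real k * \<tau>)) \<le> real L * q ^ k * norm x0" for k
      using orbit[of "\<lambda>k. x (real k * \<tau>)" k] x by (simp add: mild_solution_def)
    define k where "k = nat \<lfloor>t / \<tau>\<rfloor>"
    have "real k \<le> t / \<tau>" "t / \<tau> \<le> real k + 1"
      using t tau unfolding k_def by (auto simp: of_nat_nat)
    then have k: "real k * \<tau> \<le> t" "t \<le> (real k + 1) * \<tau>" using tau by (auto simp: field_simps)
    have "norm (x t) \<le> K * norm (x (real k * \<tau>))"
      using interval[of t k] norm_sample_map_le[where f = f and F = F and B = B and c = "x (real k * \<tau>)"
          and s = "t - real k * \<tau>" and \<tau> = \<tau>, OF T f] k
      by (simp add: K_def algebra_simps)
    also have "\<dots> \<le> K * (real L * q ^ k * norm x0)"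
      using grid K by (intro mult_left_mono) auto
    also have "\<dots> = K * real L * norm x0 * q ^ k" by simp
    also have "\<dots> \<le> K * real L * norm x0 * (inverse q * exp (- chi * t))"
      unfolding chi_def using geometric_le_exponential[OF q tau(1) k(2)] K
      by (intro mult_left_mono) auto
    finally show ?thesis by (simp add: G_def algebra_simps)
  qed
  then show "\<exists>G\<ge>1. \<exists>chi>0. \<forall>x0 x. mild_solution T B F f \<tau> x0 x \<longrightarrow>
      (\<forall>t\<ge>0. norm (x t) \<le> G * exp (- chi * t) * norm x0)"
    using G chi by blast
qed

end
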